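(* (Transfer Principle.) There exists a function $\delta:\mathbb{R}\to\mathbb{R}^\omega$ (from $\mathcal{R}$ to ${}^\dagger\mathcal{R}$) such that for any $\mathscr{L}$-formula $\phi(\overline{x})$ and any tuple of reals $\overline{r}$ (of the same length as $\overline{x}$), the following are equivalent: (i) $\mathcal{R}\models\phi(\overline{r})$; (ii) $F_0\Vdash\phi(\overline{\delta(r)})$; (iii) ${}^\dagger\mathcal{R}\models\phi(\overline{\delta(r)})$, where $\overline{\delta(r)}$ is obtained by applying $\delta$ componentwise to $\overline{r}$. In particular, for any $\mathscr{L}$-sentence $\phi$, $\mathcal{R}\models\phi$ iff ${}^\dagger\mathcal{R}\models\phi$ iff $F_0\Vdash\phi$.
   Context: Background theory: ZF + Dependent Choices. The Fréchet filter $F_0$ is the filter of cofinite subsets of $\omega$; $\mathfrak{F}$ is the set of all proper filters on $\omega$ extending $F_0$. $\mathscr{L}$ is the first-order language (with equality) with a relation symbol for every finitary relation on $\mathbb{R}$ and a function symbol for every finitary function on $\mathbb{R}$; $\mathcal{R}$ is the $\mathscr{L}$-structure with domain $\mathbb{R}$ interpreting each symbol as the relation or function it corresponds to. The $F$-hyperreal line ${}^\dagger\mathcal{R}$ is the possibility structure with set of viewpoints $\mathfrak{F}$ (ordered by reverse inclusion) and domain $\mathbb{R}^\omega$ (so "elements of ${}^\dagger\mathcal{R}$" are functions $a:\omega\to\mathbb{R}$), where function symbols are interpreted pointwise. For a tuple $\overline{a}=(a_1,\dots,a_n)$, $\overline{a}(i)=(a_1(i),\dots,a_n(i))$. The forcing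 relation $F\Vdash\phi(\overline{a})$ is defined inductively for $F\in\mathfrak{F}$ by: - for $\phi$ atomic (including equations between terms, terms being evaluated pointwise): $F\Vdash\phi(\overline{a})$ iff $\{i\in\omega:\mathcal{R}\models\phi(\overline{a}(i))\}\in F$; - $F\Vdash\neg\psi$ iff for all $G\in\mathfrak{F}$ with $G\supseteq F$, $G\nVdash\psi$; - $F\Vdash\psi\wedge\chi$ iff $F\Vdash\psi$ and $F\Vdash\chi$; - $F\Vdash\psi\vee\chi$ iff for all $G\supseteq F$ in $\mathfrak{F}$ there is $H\supseteq G$ in $\mathfrak{F}$ with $H\Vdash\psi$ or $H\Vdash\chi$; - $F\Vdash\psi\to\chi$ iff for all $G\supseteq F$ in $\mathfrak{F}$, $G\Vdash\psi$ implies $G\Vdash\chi$; - $F\Vdash\forall x\psi$ iff $F\Vdash\psi(b)$ for all $b\in\mathbb{R}^\omega$; - $F\Vdash\exists x\psi$ iff for all $G\supseteq F$ in $\mathfrak{F}$ there are $H\supseteq G$ in $\mathfrak{F}$ and $b\in\mathbb{R}^\omega$ with $H\Vdash\psi(b)$. ${}^\dagger\mathcal{R}\models\phi(\overline{a})$ means that $F\Vdash\phi(\overline{a})$ for all $F\in\mathfrak{F}$. *)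

theory Defs
  imports Complex_Main "HOL-Library.FuncSet"
begin

definition tuples :: "nat \<Rightarrow> real list set" where
  "tuples n = {xs. length xs = n}"

text \<open>The \<open>n\<close>-ary symbols of the language are the \<open>n\<close>-ary relations and functions themselves. The
  functions are extensional, so that each function on tuples is exactly one symbol.\<close>

definition rel_symbols :: "nat \<Rightarrow> real list set set" where
  "rel_symbols n = Pow (tuples n)"

definition fun_symbols :: "nat \<Rightarrow> (real list \<Rightarrow> real) set" where
  "fun_symbols n = tuples n \<rightarrow>\<^sub>E UNIV"

text \<open>Variables are de Bruijn indices: under a tuple \<open>[a\<^sub>0, \<dots>, a\<^sub>n\<^sub>-\<^sub>1]\<close> the index \<open>k\<close> denotes \<open>a\<^sub>k\<close>,
  and a quantifier puts its bound variable at the front of the tuple. The first argument of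
  \<open>Fn\<close> and \<open>Rel\<close> is the arity, which keeps apart the empty relations of different arities.\<close>

datatype trm =
    Var nat
  | Fn nat "real list \<Rightarrow> real" "trm list"

datatype fml =
    Rel nat "real list set" "trm list"
  | Eq trm trm
  | Neg fml
  | And fml fml
  | Or fml fml
  | Imp fml fml
  | All fml
  | Ex fml

text \<open>\<open>is_term n\<close> and \<open>is_formula n\<close> describe the well-formed terms and formulas with free
  variables among \<open>x\<^sub>0, \<dots>, x\<^sub>n\<^sub>-\<^sub>1\<close>; sentences are the case \<open>n = 0\<close>.\<close>

fun is_term :: "nat \<Rightarrow> trm \<Rightarrow> bool" where
  "is_term n (Var k) \<longleftrightarrow> k < n"
| "is_term n (Fn m f ts) \<longleftrightarrow> f \<in> fun_symbols m \<and> length ts = m \<and> (\<forall>t\<in>set ts. is_term n t)"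

fun is_formula :: "nat \<Rightarrow> fml \<Rightarrow> bool" where
  "is_formula n (Rel m P ts) \<longleftrightarrow> P \<in> rel_symbols m \<and> length ts = m \<and> (\<forall>t\<in>set ts. is_term n t)"
| "is_formula n (Eq s t) \<longleftrightarrow> is_term n s \<and> is_term n t"
| "is_formula n (Neg \<phi>) \<longleftrightarrow> is_formula n \<phi>"
| "is_formula n (And \<phi> \<psi>) \<longleftrightarrow> is_formula n \<phi> \<and> is_formula n \<psi>"
| "is_formula n (Or \<phi> \<psi>) \<longleftrightarrow> is_formula n \<phi> \<and> is_formula n \<psi>"
| "is_formula n (Imp \<phi> \<psi>) \<longleftrightarrow> is_formula n \<phi> \<and> is_formula n \<psi>"
| "is_formula n (All \<phi>) \<longleftrightarrow> is_formula (Suc n) \<phi>"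
| "is_formula n (Ex \<phi>) \<longleftrightarrow> is_formula (Suc n) \<phi>"

abbreviation is_sentence :: "fml \<Rightarrow> bool" where
  "is_sentence \<equiv> is_formula 0"

fun eval :: "real list \<Rightarrow> trm \<Rightarrow> real" where
  "eval rs (Var k) = rs ! k"
| "eval rs (Fn m f ts) = f (map (eval rs) ts)"

fun real_sat :: "fml \<Rightarrow> real list \<Rightarrow> bool" where
  "real_sat (Rel m P ts) rs \<longleftrightarrow> map (eval rs) ts \<in> P"
| "real_sat (Eq s t) rs \<longleftrightarrow> eval rs s = eval rs t"
| "real_sat (Neg \<phi>) rs \<longleftrightarrow> \<not> real_sat \<phi> rs"
| "real_sat (And \<phi> \<psi>) rs \<longleftrightarrow> real_sat \<phi> rs \<and> real_sat \<psi> rs"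
| "real_sat (Or \<phi> \<psi>) rs \<longleftrightarrow> real_sat \<phi> rs \<or> real_sat \<psi> rs"
| "real_sat (Imp \<phi> \<psi>) rs \<longleftrightarrow> (real_sat \<phi> rs \<longrightarrow> real_sat \<psi> rs)"
| "real_sat (All \<phi>) rs \<longleftrightarrow> (\<forall>r. real_sat \<phi> (r # rs))"
| "real_sat (Ex \<phi>) rs \<longleftrightarrow> (\<exists>r. real_sat \<phi> (r # rs))"

text \<open>The library orders filters by reverse inclusion of the families of sets they contain, so
  \<open>G \<le> F\<close> says that \<open>G\<close> extends \<open>F\<close>; the improper filter is \<open>bot\<close>, and \<open>eventually P F\<close> says that
  the set of all \<open>i\<close> with \<open>P i\<close> is a member of \<open>F\<close>.\<close>

abbreviation frechet :: "nat filter" where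
  "frechet \<equiv> cofinite"

definition viewpoints :: "nat filter set" where
  "viewpoints = {F. F \<noteq> bot \<and> F \<le> frechet}"

definition at_index :: "(nat \<Rightarrow> real) list \<Rightarrow> nat \<Rightarrow> real list" where
  "at_index as i = map (\<lambda>a. a i) as"

text \<open>In the atomic clauses, evaluating the terms in the reals at \<open>at_index as i\<close> is the
  evaluation at \<open>i\<close> of the pointwise interpretation of the function symbols.\<close>

fun forces :: "nat filter \<Rightarrow> fml \<Rightarrow> (nat \<Rightarrow> real) list \<Rightarrow> bool" where
  "forces F (Rel m P ts) as \<longleftrightarrow> eventually (\<lambda>i. real_sat (Rel m P ts) (at_index as i)) F"
| "forces F (Eq s t) as \<longleftrightarrow> eventually (\<lambda>i. real_sat (Eq s t) (at_index as i)) F"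
| "forces F (Neg \<phi>) as \<longleftrightarrow> (\<forall>G\<in>viewpoints. G \<le> F \<longrightarrow> \<not> forces G \<phi> as)"
| "forces F (And \<phi> \<psi>) as \<longleftrightarrow> forces F \<phi> as \<and> forces F \<psi> as"
| "forces F (Or \<phi> \<psi>) as \<longleftrightarrow>
     (\<forall>G\<in>viewpoints. G \<le> F \<longrightarrow> (\<exists>H\<in>viewpoints. H \<le> G \<and> (forces H \<phi> as \<or> forces H \<psi> as)))"
| "forces F (Imp \<phi> \<psi>) as \<longleftrightarrow>
     (\<forall>G\<in>viewpoints. G \<le> F \<longrightarrow> forces G \<phi> as \<longrightarrow> forces G \<psi> as)"
| "forces F (All \<phi>) as \<longleftrightarrow> (\<forall>b. forces F \<phi> (b # as))"
| "forces F (Ex \<phi>) as \<longleftrightarrow>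
     (\<forall>G\<in>viewpoints. G \<le> F \<longrightarrow> (\<exists>H\<in>viewpoints. H \<le> G \<and> (\<exists>b. forces H \<phi> (b # as))))"

definition hyperreal_sat :: "fml \<Rightarrow> (nat \<Rightarrow> real) list \<Rightarrow> bool" where
  "hyperreal_sat \<phi> as \<longleftrightarrow> (\<forall>F\<in>viewpoints. forces F \<phi> as)"

end

theory Submission
  imports Defs
begin

text \<open>
  Take \<open>\<delta> r\<close> to be the constant sequence with value \<open>r\<close>. The result rests on an analogue of Los's
  theorem without ultrafilters (\<open>forces_iff_eventually_real_sat\<close>): a viewpoint forces a formula at
  a tuple of sequences iff the formula holds in the reals at almost every index in the sense of that
  filter. For constant sequences, truth does not depend on the index, and as a viewpoint is
  a proper filter, forcing at any single viewpoint is then the same as truth in the reals.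

  For an arbitrary filter, truth at almost every index commutes neither with negation nor with
  disjunction. The clauses for \<open>Neg\<close>, \<open>Or\<close>, \<open>Imp\<close> and \<open>Ex\<close> compensate for this by quantifying
  over the extensions of the viewpoint. What makes them work is that a set of indices whose
  complement is not in a viewpoint can be added to it, giving a larger viewpoint
  (\<open>frequently_imp_refinement\<close>).
  Quantifiers are handled by choosing, index by index, a real witness or counterexample, and by
  using the sequence of these choices as the element to substitute.
\<close>

lemma viewpoint_not_eventually_False:
  assumes "F \<in> viewpoints" "eventually P F" "eventually (\<lambda>i. \<not> P i) F"
  shows False
proof -
  have "eventually (\<lambda>i. False) F"
    using assms(2,3) by eventually_elim simp
  then show False
    using assms(1) by (simp add: viewpoints_def trivial_limit_def)
qed

text \<open>
  The refinement is generated by the viewpoint and the set of indices where \<open>P\<close> holds. It is proper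
  because a member of the viewpoint disjoint from that set would make \<open>P\<close> fail almost everywhere.
\<close>

lemma frequently_imp_refinement:
  assumes "F \<in> viewpoints" "frequently P F"
  obtains G where "G \<in> viewpoints" "G \<le> F" "eventually P G"
proof
  let ?G = "inf F (principal {i. P i})"
  have "?G \<noteq> bot"
    using assms(2) by (simp add: trivial_limit_def eventually_inf_principal frequently_def)
  then show "?G \<in> viewpoints"
    using assms(1) by (auto simp: viewpoints_def intro: le_infI1)
  show "?G \<le> F" by simp
  show "eventually P ?G" by (simp add: eventually_inf_principal)
qed

lemma eventually_not_iff_no_refinement:
  assumes "F \<in> viewpoints"
  shows "(\<forall>G\<in>viewpoints. G \<le> F \<longrightarrow> \<not> eventually P G) \<longleftrightarrow> eventually (\<lambda>i. \<not> P i) F"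
proof
  assume none: "\<forall>G\<in>viewpoints. G \<le> F \<longrightarrow> \<not> eventually P G"
  show "eventually (\<lambda>i. \<not> P i) F"
  proof (rule ccontr)
    assume "\<not> eventually (\<lambda>i. \<not> P i) F"
    then have "frequently P F" by (simp add: frequently_def)
    with assms none show False by (blast elim: frequently_imp_refinement)
  qed
next
  assume "eventually (\<lambda>i. \<not> P i) F"
  then show "\<forall>G\<in>viewpoints. G \<le> F \<longrightarrow> \<not> eventually P G"
    by (blast dest: filter_leD viewpoint_not_eventually_False)
qed

text \<open>
  A set that is not in a viewpoint can be excluded for good by adding its complement, so a set that
  remains addable at every later stage must already be present. This is why the clauses for
  \<open>Or\<close> and \<open>Ex\<close>, which only ask for their condition densely often, cannot force too much.
\<close>

lemma eventually_if_dense: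
  assumes "F \<in> viewpoints"
    and "\<And>G. G \<in> viewpoints \<Longrightarrow> G \<le> F \<Longrightarrow> \<exists>H\<in>viewpoints. H \<le> G \<and> eventually P H"
  shows "eventually P F"
proof (rule ccontr)
  assume "\<not> eventually P F"
  then have "frequently (\<lambda>i. \<not> P i) F" by (simp add: frequently_def)
  with assms(1) obtain G where G: "G \<in> viewpoints" "G \<le> F" "eventually (\<lambda>i. \<not> P i) G"
    by (rule frequently_imp_refinement)
  with assms(2) obtain H where "H \<in> viewpoints" "H \<le> G" "eventually P H" by blast
  with G show False by (blast dest: filter_leD viewpoint_not_eventually_False)
qed

lemma eventually_disj_iff_dense:
  assumes "F \<in> viewpoints"
  shows "(\<forall>G\<in>viewpoints. G \<le> F \<longrightarrow>
            (\<exists>H\<in>viewpoints. H \<le> G \<and> (eventually P H \<or> eventually Q H))) \<longleftrightarrow>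
         eventually (\<lambda>i. P i \<or> Q i) F" (is "?dense \<longleftrightarrow> _")
proof
  assume ?dense
  moreover have "eventually (\<lambda>i. P i \<or> Q i) H" if "eventually P H \<or> eventually Q H" for H
    using that by (auto elim: eventually_mono)
  ultimately show "eventually (\<lambda>i. P i \<or> Q i) F"
    using assms by (intro eventually_if_dense) blast+
next
  assume ev: "eventually (\<lambda>i. P i \<or> Q i) F"
  show ?dense
  proof (intro ballI impI)
    fix G assume G: "G \<in> viewpoints" "G \<le> F"
    have "eventually (\<lambda>i. P i \<or> Q i) G" using ev G(2) by (rule filter_leD[rotated])
    moreover have "G \<noteq> bot" using G(1) by (simp add: viewpoints_def)
    ultimately have "frequently P G \<or> frequently Q G"
      by (metis eventually_frequently frequently_disj_iff)
    with G(1) show "\<exists>H\<in>viewpoints. H \<le> G \<and> (eventually P H \<or> eventually Q H)"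
      by (blast elim: frequently_imp_refinement)
  qed
qed

lemma eventually_imp_iff_refinements:
  assumes "F \<in> viewpoints"
  shows "(\<forall>G\<in>viewpoints. G \<le> F \<longrightarrow> eventually P G \<longrightarrow> eventually Q G) \<longleftrightarrow>
         eventually (\<lambda>i. P i \<longrightarrow> Q i) F" (is "?persists \<longleftrightarrow> _")
proof
  assume persists: ?persists
  show "eventually (\<lambda>i. P i \<longrightarrow> Q i) F"
  proof (rule ccontr)
    assume "\<not> eventually (\<lambda>i. P i \<longrightarrow> Q i) F"
    then have "frequently (\<lambda>i. P i \<and> \<not> Q i) F" by (simp add: frequently_def)
    with assms obtain G where G: "G \<in> viewpoints" "G \<le> F" "eventually (\<lambda>i. P i \<and> \<not> Q i) G"
      by (rule frequently_imp_refinement)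
    then have "eventually Q G" "eventually (\<lambda>i. \<not> Q i) G"
      using persists by (auto simp: eventually_conj_iff)
    with G(1) show False by (rule viewpoint_not_eventually_False)
  qed
next
  assume "eventually (\<lambda>i. P i \<longrightarrow> Q i) F"
  then show ?persists by (metis eventually_mp filter_leD)
qed

text \<open>
  If \<open>P i r\<close> can fail for some \<open>r\<close>, the sequence that chooses such an \<open>r\<close> wherever there is one
  is the hardest instance: whenever it satisfies \<open>P\<close> at \<open>i\<close>, every \<open>r\<close> does.
\<close>

lemma eventually_all_iff_sequences:
  "(\<forall>b. eventually (\<lambda>i. P i (b i)) F) \<longleftrightarrow> eventually (\<lambda>i. \<forall>r. P i r) F"
proof
  assume all: "\<forall>b. eventually (\<lambda>i. P i (b i)) F"
  have "eventually (\<lambda>i. P i (SOME r. \<not> P i r)) F"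
    using all by (rule spec)
  then show "eventually (\<lambda>i. \<forall>r. P i r) F"
  proof (rule eventually_mono)
    fix i assume "P i (SOME r. \<not> P i r)"
    then show "\<forall>r. P i r"
      using someI_ex[of "\<lambda>r. \<not> P i r"] by blast
  qed
next
  assume "eventually (\<lambda>i. \<forall>r. P i r) F"
  then have "eventually (\<lambda>i. P i (b i)) F" for b
    by (rule eventually_mono) (rule spec)
  then show "\<forall>b. eventually (\<lambda>i. P i (b i)) F" ..
qed

lemma eventually_ex_iff_sequence:
  "(\<exists>b. eventually (\<lambda>i. P i (b i)) F) \<longleftrightarrow> eventually (\<lambda>i. \<exists>r. P i r) F"
proof
  assume "eventually (\<lambda>i. \<exists>r. P i r) F"
  then have "eventually (\<lambda>i. P i (SOME r. P i r)) F"
    by (rule eventually_mono) (rule someI_ex)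
  then show "\<exists>b. eventually (\<lambda>i. P i (b i)) F"
    by (rule exI[where x = "\<lambda>i. SOME r. P i r"])
next
  assume "\<exists>b. eventually (\<lambda>i. P i (b i)) F"
  then obtain b where "eventually (\<lambda>i. P i (b i)) F" ..
  then show "eventually (\<lambda>i. \<exists>r. P i r) F"
    by (rule eventually_mono) (rule exI)
qed

lemma eventually_ex_iff_dense:
  assumes "F \<in> viewpoints"
  shows "(\<forall>G\<in>viewpoints. G \<le> F \<longrightarrow>
            (\<exists>H\<in>viewpoints. H \<le> G \<and> (\<exists>b. eventually (\<lambda>i. P i (b i)) H))) \<longleftrightarrow>
         eventually (\<lambda>i. \<exists>r. P i r) F"
  unfolding eventually_ex_iff_sequence
proof
  assume "\<forall>G\<in>viewpoints. G \<le> F \<longrightarrow> (\<exists>H\<in>viewpoints. H \<le> G \<and> eventually (\<lambda>i. \<exists>r. P i r) H)"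
  with assms show "eventually (\<lambda>i. \<exists>r. P i r) F"
    by (intro eventually_if_dense) simp_all
next
  assume ev: "eventually (\<lambda>i. \<exists>r. P i r) F"
  show "\<forall>G\<in>viewpoints. G \<le> F \<longrightarrow> (\<exists>H\<in>viewpoints. H \<le> G \<and> eventually (\<lambda>i. \<exists>r. P i r) H)"
    using filter_leD[OF _ ev] by blast
qed

lemma at_index_Cons: "at_index (b # as) i = b i # at_index as i"
  by (simp add: at_index_def)

text \<open>
  The induction is over all viewpoints and all tuples at once, as the clauses for the connectives
  pass to extensions of the viewpoint and those for the quantifiers lengthen the tuple. In each case
  the induction hypothesis turns the forcing clause into a statement about filters alone.
\<close>

theorem forces_iff_eventually_real_sat:
  assumes "F \<in> viewpoints"
  shows "forces F \<phi> as \<longleftrightarrow> eventually (\<lambda>i. real_sat \<phi> (at_index as i)) F"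
  using assms
proof (induction \<phi> arbitrary: F as)
  case (Neg \<phi>)
  then show ?case by (simp add: eventually_not_iff_no_refinement cong: ball_cong)
next
  case (And \<phi> \<psi>)
  then show ?case by (simp add: eventually_conj_iff)
next
  case (Or \<phi> \<psi>)
  then show ?case by (simp add: eventually_disj_iff_dense cong: ball_cong bex_cong)
next
  case (Imp \<phi> \<psi>)
  then show ?case by (simp add: eventually_imp_iff_refinements cong: ball_cong)
next
  case (All \<phi>)
  then show ?case
    by (simp add: at_index_Cons
        eventually_all_iff_sequences[where P = "\<lambda>i r. real_sat \<phi> (r # at_index as i)"])
next
  case (Ex \<phi>)
  then show ?case
    by (simp add: at_index_Cons cong: ball_cong bex_cong
        flip: eventually_ex_iff_dense[where P = "\<lambda>i r. real_sat \<phi> (r # at_index as i)"])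
qed simp_all

lemma at_index_constant_sequences: "at_index (map (\<lambda>r i. r) rs) i = rs"
  by (simp add: at_index_def comp_def)

lemma forces_constant_sequences_iff:
  assumes "F \<in> viewpoints"
  shows "forces F \<phi> (map (\<lambda>r i. r) rs) \<longleftrightarrow> real_sat \<phi> rs"
  using assms
  by (simp add: forces_iff_eventually_real_sat at_index_constant_sequences
      eventually_const viewpoints_def)

lemma frechet_in_viewpoints: "frechet \<in> viewpoints"
  by (simp add: viewpoints_def cofinite_bot)

lemma hyperreal_sat_constant_sequences_iff:
  "hyperreal_sat \<phi> (map (\<lambda>r i. r) rs) \<longleftrightarrow> real_sat \<phi> rs"
  using frechet_in_viewpoints by (auto simp: hyperreal_sat_def forces_constant_sequences_iff)

theorem corollary3p3:
  "(\<exists>\<delta> :: real \<Rightarrow> (nat \<Rightarrow> real).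
      \<forall>n \<phi> rs. is_formula n \<phi> \<longrightarrow> length rs = n \<longrightarrow>
        (real_sat \<phi> rs \<longleftrightarrow> forces frechet \<phi> (map \<delta> rs)) \<and>
        (forces frechet \<phi> (map \<delta> rs) \<longleftrightarrow> hyperreal_sat \<phi> (map \<delta> rs))) \<and>
   (\<forall>\<phi>. is_sentence \<phi> \<longrightarrow>
      (real_sat \<phi> [] \<longleftrightarrow> hyperreal_sat \<phi> []) \<and>
      (hyperreal_sat \<phi> [] \<longleftrightarrow> forces frechet \<phi> []))"
proof -
  note transfer = forces_constant_sequences_iff[OF frechet_in_viewpoints]
    hyperreal_sat_constant_sequences_iff
  \<comment> \<open>The empty tuple of reals is a tuple of constant sequences, which gives the claim on sentences.\<close>
  have "real_sat \<phi> [] \<longleftrightarrow> hyperreal_sat \<phi> []" "hyperreal_sat \<phi> [] \<longleftrightarrow> forces frechet \<phi> []" for \<phi>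
    using transfer[of \<phi> "[]"] by simp_all
  then show ?thesis
    using transfer by blast
qed

end
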